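(* Let $(A,\mu,\varepsilon,\alpha_A)$ be a color non-Hom-associative algebra and let $(A,[-,-],as(-,-,-),\varepsilon,\alpha_A)$ be its associated color Hom-Akivis algebra, where for homogeneous $x,y,z$ $$[x,y]=\mu(x,y)-\varepsilon(x,y)\mu(y,x),\qquad as(x,y,z)=\mu(\mu(x,y),\alpha_A(z))-\mu(\alpha_A(x),\mu(y,z)).$$ Then: 1. if $(A,\mu,\varepsilon,\alpha_A)$ is Hom-flexible, then $(A,[-,-],as(-,-,-),\varepsilon,\alpha_A)$ is Hom-flexible; 2. if $(A,\mu,\varepsilon,\alpha_A)$ is Hom-alternative, then so is $(A,[-,-],as(-,-,-),\varepsilon,\alpha_A)$.
   Context: $\mathbf K$ is a field of characteristic $0$ and $G$ is an abelian group (written additively). A linear (or multilinear) map between $G$-graded vector spaces is even if it preserves degrees. A bicharacter is a map $\varepsilon:G\times G\to\mathbf K^*$ with $\varepsilon(a,b)\varepsilon(b,a)=1$, $\varepsilon(a,b+c)=\varepsilon(a,b)\varepsilon(a,c)$, $\varepsilon(a+b,c)=\varepsilon(a,c)\varepsilon(b,c)$. For homogeneous $x,y$ of degrees $a,b$ one writes $\varepsilon(x,y):=\varepsilon(a,b)$. A (multiplicative) color non-Hom-associative algebra is a quadruple $(A,\mu,\varepsilon,\alpha_A)$ where $A$ is a $G$-graded vector space, $\mu:A\otimes A\to A$ is an even bilinear map (not required to be Hom-associative), $\varepsilon$ is a bicharacter, and $\alpha_A$ is an even endomorphism of $(A,\mu)$. It is Hom-flexible if $as(x,y,x)=0$ for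 all $x,y\in A$, and Hom-alternative if $as(x,y,z)$ is $\varepsilon$-skew-symmetric in $x,y,z$, i.e. $as(x,y,z)=-\varepsilon(x,y)as(y,x,z)$ and $as(x,y,z)=-\varepsilon(y,z)as(x,z,y)$ for homogeneous $x,y,z$. A color Hom-Akivis algebra is a quintuple $(A,[-,-],[-,-,-],\varepsilon,\alpha_A)$ consisting of a $G$-graded vector space $A$, a bicharacter $\varepsilon$, an even $\varepsilon$-skew-symmetric bilinear map $[-,-]$ ($[x,y]=-\varepsilon(x,y)[y,x]$), an even trilinear map $[-,-,-]$, and an even linear map $\alpha_A:A\to A$ such that for all homogeneous $x,y,z$ $$\oint\varepsilon(z,x)[[x,y],\alpha_A(z)]=\oint\varepsilon(z,x)\big([x,y,z]-\varepsilon(x,y)[y,x,z]\big),$$ $\oint$ denoting the sum over cyclic permutations of $x,y,z$. It is Hom-flexible if $[x,y,x]=0$ for all $x,y\in A$, and Hom-alternative if $[-,-,-]$ is $\varepsilon$-alternating, i.e. $\varepsilon$-skew-symmetric for any pair of variables: for homogeneous $x,y,z$, $[x,y,z]=-\varepsilon(x,y)[y,x,z]$, $[x,y,z]=-\varepsilon(y,z)[x,z,y]$, and $[x,y,z]=-\varepsilon(x,y)\varepsilon(x,z)\varepsilon(y,z)[z,y,x]$. *)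

theory Defs
  imports Complex_Main
begin

definition homogeneous_decomposition ::
    "('g \<Rightarrow> 'a::ab_group_add set) \<Rightarrow> 'a \<Rightarrow> ('g \<Rightarrow> 'a) \<Rightarrow> bool" where
  "homogeneous_decomposition V x f \<longleftrightarrow>
     (\<forall>g. f g \<in> V g) \<and> finite {g. f g \<noteq> 0} \<and> x = (\<Sum>g | f g \<noteq> 0. f g)"

text \<open>The vector space is the whole type \<^typ>\<open>'a\<close>, and \<open>V g\<close> is its homogeneous part of degree
  \<open>g\<close>; the axiom \<open>decomposition\<close> says that the space is the direct sum of the \<open>V g\<close>.\<close>

locale graded_vector_space = vector_space scale
  for scale :: "'k::field_char_0 \<Rightarrow> 'a::ab_group_add \<Rightarrow> 'a" (infixr \<open>*s\<close> 75) +
  fixes V :: "'g::ab_group_add \<Rightarrow> 'a set"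
  assumes subspace_V: "subspace (V g)"
    and decomposition: "\<exists>!f. homogeneous_decomposition V x f"

definition component :: "('g \<Rightarrow> 'a::ab_group_add set) \<Rightarrow> 'a \<Rightarrow> 'g \<Rightarrow> 'a" where
  "component V x = (THE f. homogeneous_decomposition V x f)"

definition bilinear_map ::
    "('k::field \<Rightarrow> 'a::ab_group_add \<Rightarrow> 'a) \<Rightarrow> ('a \<Rightarrow> 'a \<Rightarrow> 'a) \<Rightarrow> bool" where
  "bilinear_map scale f \<longleftrightarrow>
     (\<forall>y. Vector_Spaces.linear scale scale (\<lambda>x. f x y)) \<and>
     (\<forall>x. Vector_Spaces.linear scale scale (\<lambda>y. f x y))"

definition trilinear_map ::
    "('k::field \<Rightarrow> 'a::ab_group_add \<Rightarrow> 'a) \<Rightarrow> ('a \<Rightarrow> 'a \<Rightarrow> 'a \<Rightarrow> 'a) \<Rightarrow> bool" where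
  "trilinear_map scale f \<longleftrightarrow>
     (\<forall>y z. Vector_Spaces.linear scale scale (\<lambda>x. f x y z)) \<and>
     (\<forall>x z. Vector_Spaces.linear scale scale (\<lambda>y. f x y z)) \<and>
     (\<forall>x y. Vector_Spaces.linear scale scale (\<lambda>z. f x y z))"

locale bicharacter =
  fixes \<epsilon> :: "'g::ab_group_add \<Rightarrow> 'g \<Rightarrow> 'k::field"
  assumes nonzero: "\<epsilon> a b \<noteq> 0"
    and inverse: "\<epsilon> a b * \<epsilon> b a = 1"
    and add_right: "\<epsilon> a (b + c) = \<epsilon> a b * \<epsilon> a c"
    and add_left: "\<epsilon> (a + b) c = \<epsilon> a c * \<epsilon> b c"

text \<open>In the identities below, homogeneous elements come with a degree: \<open>x \<in> V a\<close>, \<open>y \<in> V b\<close>,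
  \<open>z \<in> V c\<close>, and \<open>\<epsilon>(x,y)\<close> is written \<open>\<epsilon> a b\<close>. The zero vector lies in every \<open>V a\<close>, but for it all
  these multilinear identities are trivial.\<close>

locale color_non_hom_assoc_algebra =
  graded_vector_space scale V + bicharacter \<epsilon>
  for scale :: "'k::field_char_0 \<Rightarrow> 'a::ab_group_add \<Rightarrow> 'a" (infixr \<open>*s\<close> 75)
    and V :: "'g::ab_group_add \<Rightarrow> 'a set"
    and \<mu> :: "'a \<Rightarrow> 'a \<Rightarrow> 'a"
    and \<epsilon> :: "'g \<Rightarrow> 'g \<Rightarrow> 'k"
    and \<alpha> :: "'a \<Rightarrow> 'a" +
  assumes bilinear_mult: "bilinear_map scale \<mu>"
    and even_mult: "x \<in> V a \<Longrightarrow> y \<in> V b \<Longrightarrow> \<mu> x y \<in> V (a + b)"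
    and linear_twist: "Vector_Spaces.linear scale scale \<alpha>"
    and even_twist: "x \<in> V a \<Longrightarrow> \<alpha> x \<in> V a"
    and twist_mult: "\<alpha> (\<mu> x y) = \<mu> (\<alpha> x) (\<alpha> y)"

definition hom_associator ::
    "('a::ab_group_add \<Rightarrow> 'a \<Rightarrow> 'a) \<Rightarrow> ('a \<Rightarrow> 'a) \<Rightarrow> 'a \<Rightarrow> 'a \<Rightarrow> 'a \<Rightarrow> 'a" where
  "hom_associator \<mu> \<alpha> x y z = \<mu> (\<mu> x y) (\<alpha> z) - \<mu> (\<alpha> x) (\<mu> y z)"

text \<open>The formula \<open>[x,y] = \<mu>(x,y) - \<epsilon>(x,y) \<mu>(y,x)\<close> only makes sense for homogeneous arguments; the
  bracket on the whole space is its bilinear extension.\<close>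

definition color_commutator ::
    "('k::field \<Rightarrow> 'a::ab_group_add \<Rightarrow> 'a) \<Rightarrow> ('g \<Rightarrow> 'a set) \<Rightarrow> ('a \<Rightarrow> 'a \<Rightarrow> 'a) \<Rightarrow>
      ('g \<Rightarrow> 'g \<Rightarrow> 'k) \<Rightarrow> 'a \<Rightarrow> 'a \<Rightarrow> 'a" where
  "color_commutator scale V \<mu> \<epsilon> x y =
     (\<Sum>a | component V x a \<noteq> 0. \<Sum>b | component V y b \<noteq> 0.
        \<mu> (component V x a) (component V y b)
        - scale (\<epsilon> a b) (\<mu> (component V y b) (component V x a)))"

lemma (in graded_vector_space) component_homogeneous:
  assumes "x \<in> V a"
  shows "component V x = (\<lambda>g. if g = a then x else 0)"
proof -
  have "{g. (if g = a then x else 0) \<noteq> 0} = (if x = 0 then {} else {a})" by auto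
  then have "homogeneous_decomposition V x (\<lambda>g. if g = a then x else 0)"
    using assms subspace_0[OF subspace_V] by (auto simp: homogeneous_decomposition_def)
  then show ?thesis
    unfolding component_def by (rule the1_equality[OF decomposition])
qed

lemma (in color_non_hom_assoc_algebra) color_commutator_homogeneous:
  assumes "x \<in> V a" "y \<in> V b"
  shows "color_commutator scale V \<mu> \<epsilon> x y = \<mu> x y - \<epsilon> a b *s \<mu> y x"
proof -
  have *: "{g. (if g = c then u else 0) \<noteq> 0} = (if u = 0 then {} else {c})" for c :: 'g and u :: 'a
    by auto
  have "\<mu> (0 + 0) z = \<mu> 0 z + \<mu> 0 z" "\<mu> z (0 + 0) = \<mu> z 0 + \<mu> z 0" for z
    using bilinear_mult unfolding bilinear_map_def Vector_Spaces.linear_iff by blast+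
  then have "\<mu> 0 z = 0" "\<mu> z 0 = 0" for z
    by simp_all
  then show ?thesis
    unfolding color_commutator_def component_homogeneous[OF assms(1)]
      component_homogeneous[OF assms(2)] *
    by auto
qed

locale hom_flexible_color_algebra = color_non_hom_assoc_algebra +
  assumes flexible: "hom_associator \<mu> \<alpha> x y x = 0"

locale hom_alternative_color_algebra = color_non_hom_assoc_algebra +
  assumes alternative_left:
      "x \<in> V a \<Longrightarrow> y \<in> V b \<Longrightarrow> z \<in> V c \<Longrightarrow>
        hom_associator \<mu> \<alpha> x y z = - (\<epsilon> a b *s hom_associator \<mu> \<alpha> y x z)"
    and alternative_right:
      "x \<in> V a \<Longrightarrow> y \<in> V b \<Longrightarrow> z \<in> V c \<Longrightarrow>
        hom_associator \<mu> \<alpha> x y z = - (\<epsilon> b c *s hom_associator \<mu> \<alpha> x z y)"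

locale color_hom_akivis_algebra =
  graded_vector_space scale V + bicharacter \<epsilon>
  for scale :: "'k::field_char_0 \<Rightarrow> 'a::ab_group_add \<Rightarrow> 'a" (infixr \<open>*s\<close> 75)
    and V :: "'g::ab_group_add \<Rightarrow> 'a set"
    and br :: "'a \<Rightarrow> 'a \<Rightarrow> 'a"
    and tr :: "'a \<Rightarrow> 'a \<Rightarrow> 'a \<Rightarrow> 'a"
    and \<epsilon> :: "'g \<Rightarrow> 'g \<Rightarrow> 'k"
    and \<alpha> :: "'a \<Rightarrow> 'a" +
  assumes bilinear_br: "bilinear_map scale br"
    and even_br: "x \<in> V a \<Longrightarrow> y \<in> V b \<Longrightarrow> br x y \<in> V (a + b)"
    and skew_br: "x \<in> V a \<Longrightarrow> y \<in> V b \<Longrightarrow> br x y = - (\<epsilon> a b *s br y x)"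
    and trilinear_tr: "trilinear_map scale tr"
    and even_tr: "x \<in> V a \<Longrightarrow> y \<in> V b \<Longrightarrow> z \<in> V c \<Longrightarrow> tr x y z \<in> V (a + b + c)"
    and linear_twist: "Vector_Spaces.linear scale scale \<alpha>"
    and even_twist: "x \<in> V a \<Longrightarrow> \<alpha> x \<in> V a"
    and akivis_identity:
      "x \<in> V a \<Longrightarrow> y \<in> V b \<Longrightarrow> z \<in> V c \<Longrightarrow>
         \<epsilon> c a *s br (br x y) (\<alpha> z)
       + \<epsilon> a b *s br (br y z) (\<alpha> x)
       + \<epsilon> b c *s br (br z x) (\<alpha> y)
       = \<epsilon> c a *s (tr x y z - \<epsilon> a b *s tr y x z)
       + \<epsilon> a b *s (tr y z x - \<epsilon> b c *s tr z y x)
       + \<epsilon> b c *s (tr z x y - \<epsilon> c a *s tr x z y)"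

locale hom_flexible_color_hom_akivis_algebra = color_hom_akivis_algebra +
  assumes flexible: "tr x y x = 0"

locale hom_alternative_color_hom_akivis_algebra = color_hom_akivis_algebra +
  assumes alternating_12:
      "x \<in> V a \<Longrightarrow> y \<in> V b \<Longrightarrow> z \<in> V c \<Longrightarrow> tr x y z = - (\<epsilon> a b *s tr y x z)"
    and alternating_23:
      "x \<in> V a \<Longrightarrow> y \<in> V b \<Longrightarrow> z \<in> V c \<Longrightarrow> tr x y z = - (\<epsilon> b c *s tr x z y)"
    and alternating_13:
      "x \<in> V a \<Longrightarrow> y \<in> V b \<Longrightarrow> z \<in> V c \<Longrightarrow>
        tr x y z = - ((\<epsilon> a b * \<epsilon> a c * \<epsilon> b c) *s tr z y x)"

end

theory Submission
  imports Defs
begin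

text \<open>Multiplying \<open>[[x,y],\<alpha>(z)]\<close> by \<open>\<epsilon>(z,x)\<close> turns the coefficient \<open>\<epsilon>(x+y,z)\<close> of \<open>\<mu>(\<alpha>(z),\<mu>(x,y))\<close>
  into \<open>\<epsilon>(y,z)\<close>, which is the coefficient of \<open>as(z,x,y)\<close> in the cyclic sum; hence the Akivis
  identity holds term by term. The flexible and alternative laws only concern the associator, and
  skew-symmetry in the outer variables follows by composing three adjacent transpositions.\<close>

context graded_vector_space
begin

text \<open>The direct-sum axiom makes the definite description behind \<open>component\<close>
  meaningful.\<close>

lemma homogeneous_decomposition_component: "homogeneous_decomposition V x (component V x)"
  unfolding component_def by (rule theI'[OF decomposition])

lemma component_unique: "homogeneous_decomposition V x f \<Longrightarrow> component V x = f"
  unfolding component_def by (rule the1_equality[OF decomposition])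

lemma component_in: "component V x g \<in> V g"
  and finite_component: "finite {g. component V x g \<noteq> 0}"
  and sum_component: "(\<Sum>g | component V x g \<noteq> 0. component V x g) = x"
  using homogeneous_decomposition_component[of x]
  unfolding homogeneous_decomposition_def by auto

text \<open>Indices outside the support add only zeros. This lets vectors with different supports be
  expanded over one common index set.\<close>

lemma sum_component_superset:
  assumes "finite S" "{g. component V x g \<noteq> 0} \<subseteq> S"
  shows "(\<Sum>g\<in>S. component V x g) = x"
proof -
  have "(\<Sum>g | component V x g \<noteq> 0. component V x g) = (\<Sum>g\<in>S. component V x g)"
    using assms by (intro sum.mono_neutral_left) auto
  then show ?thesis by (simp add: sum_component)
qed

lemma homogeneous_decompositionI:
  assumes "\<And>g. f g \<in> V g" "finite S" "{g. f g \<noteq> 0} \<subseteq> S" "(\<Sum>g\<in>S. f g) = x"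
  shows "homogeneous_decomposition V x f"
proof -
  have "(\<Sum>g | f g \<noteq> 0. f g) = (\<Sum>g\<in>S. f g)"
    using assms(2,3) by (intro sum.mono_neutral_left) auto
  then show ?thesis
    using assms finite_subset[OF assms(3,2)] by (simp add: homogeneous_decomposition_def)
qed

text \<open>Decompositions are unique, so it suffices that the pointwise sum decomposes
  \<open>x + y\<close>. Its support may shrink by cancellation, hence the use of a superset.\<close>

lemma component_add: "component V (x + y) g = component V x g + component V y g"
proof -
  let ?S = "{g. component V x g \<noteq> 0} \<union> {g. component V y g \<noteq> 0}"
  have "homogeneous_decomposition V (x + y) (\<lambda>g. component V x g + component V y g)"
  proof (rule homogeneous_decompositionI[where S = ?S])
    show "finite ?S" by (simp add: finite_component)
    then show "(\<Sum>g\<in>?S. component V x g + component V y g) = x + y"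
      by (simp add: sum.distrib sum_component_superset)
  qed (auto intro: subspace_add[OF subspace_V] component_in)
  then show ?thesis by (simp add: component_unique)
qed

lemma component_scale: "component V (k *s x) g = k *s component V x g"
proof -
  let ?S = "{g. component V x g \<noteq> 0}"
  have "homogeneous_decomposition V (k *s x) (\<lambda>g. k *s component V x g)"
    by (rule homogeneous_decompositionI[where S = ?S])
      (auto intro: subspace_scale[OF subspace_V] component_in finite_component
        simp: sum_component simp flip: scale_sum_right)
  then show ?thesis by (simp add: component_unique)
qed

end

context color_non_hom_assoc_algebra
begin

lemma mult_linear:
  "\<mu> (x + x') y = \<mu> x y + \<mu> x' y" "\<mu> x (y + y') = \<mu> x y + \<mu> x y'"
  "\<mu> (k *s x) y = k *s \<mu> x y" "\<mu> x (k *s y) = k *s \<mu> x y"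
  using bilinear_mult unfolding bilinear_map_def Vector_Spaces.linear_iff by blast+

lemma mult_zero: "\<mu> 0 y = 0" "\<mu> x 0 = 0"
  using mult_linear(1)[of 0 0 y] mult_linear(2)[of x 0 0] by simp_all

lemma mult_diff:
  "\<mu> (x - x') y = \<mu> x y - \<mu> x' y" "\<mu> x (y - y') = \<mu> x y - \<mu> x y'"
  by (metis add_diff_cancel diff_add_cancel mult_linear(1))
    (metis add_diff_cancel diff_add_cancel mult_linear(2))

lemma twist_linear: "\<alpha> (x + y) = \<alpha> x + \<alpha> y" "\<alpha> (k *s x) = k *s \<alpha> x"
  using linear_twist unfolding Vector_Spaces.linear_iff by blast+

text \<open>The definition sums over exact supports, which vary with the arguments. Terms with a
  zero component vanish, so fixed larger index sets may replace them, and bilinearity can be checked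
  term by term.\<close>

lemma color_commutator_superset:
  assumes S: "finite S" "{g. component V x g \<noteq> 0} \<subseteq> S"
    and T: "finite T" "{g. component V y g \<noteq> 0} \<subseteq> T"
  shows "color_commutator scale V \<mu> \<epsilon> x y =
    (\<Sum>a\<in>S. \<Sum>b\<in>T. \<mu> (component V x a) (component V y b)
      - \<epsilon> a b *s \<mu> (component V y b) (component V x a))"
proof -
  have inner: "(\<Sum>b | component V y b \<noteq> 0. \<mu> u (component V y b) - \<epsilon> a b *s \<mu> (component V y b) u) =
    (\<Sum>b\<in>T. \<mu> u (component V y b) - \<epsilon> a b *s \<mu> (component V y b) u)" for u a
    using T by (intro sum.mono_neutral_left) (auto simp: mult_zero)
  show ?thesis
    unfolding color_commutator_def inner
    using S by (intro sum.mono_neutral_left) (auto simp: mult_zero)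
qed

lemma color_commutator_add_left:
  "color_commutator scale V \<mu> \<epsilon> (x + x') y =
    color_commutator scale V \<mu> \<epsilon> x y + color_commutator scale V \<mu> \<epsilon> x' y"
proof -
  let ?S = "{g. component V x g \<noteq> 0} \<union> {g. component V x' g \<noteq> 0}"
  let ?T = "{g. component V y g \<noteq> 0}"
  have fin: "finite ?S" "finite ?T" by (simp_all add: finite_component)
  \<comment> \<open>All three commutators thereby become sums over the same index sets
    \<open>?S\<close> and \<open>?T\<close>.\<close>
  have "{g. component V (x + x') g \<noteq> 0} \<subseteq> ?S" by (auto simp: component_add)
  then show ?thesis
    using fin by (simp add: color_commutator_superset[where S = ?S and T = ?T] component_add
        mult_linear scale_right_distrib sum.distrib[symmetric] algebra_simps)
qed

lemma color_commutator_add_right: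
  "color_commutator scale V \<mu> \<epsilon> x (y + y') =
    color_commutator scale V \<mu> \<epsilon> x y + color_commutator scale V \<mu> \<epsilon> x y'"
proof -
  let ?S = "{g. component V x g \<noteq> 0}"
  let ?T = "{g. component V y g \<noteq> 0} \<union> {g. component V y' g \<noteq> 0}"
  have fin: "finite ?S" "finite ?T" by (simp_all add: finite_component)
  have "{g. component V (y + y') g \<noteq> 0} \<subseteq> ?T" by (auto simp: component_add)
  then show ?thesis
    using fin by (simp add: color_commutator_superset[where S = ?S and T = ?T] component_add
        mult_linear scale_right_distrib sum.distrib[symmetric] algebra_simps)
qed

lemma color_commutator_scale:
  "color_commutator scale V \<mu> \<epsilon> (k *s x) y = k *s color_commutator scale V \<mu> \<epsilon> x y"
  "color_commutator scale V \<mu> \<epsilon> x (k *s y) = k *s color_commutator scale V \<mu> \<epsilon> x y"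
proof -
  let ?S = "{g. component V x g \<noteq> 0}" and ?T = "{g. component V y g \<noteq> 0}"
  have fin: "finite ?S" "finite ?T" by (simp_all add: finite_component)
  \<comment> \<open>Inclusions rather than equalities, so that \<open>k = 0\<close> is
    covered.\<close>
  have sub: "{g. component V (k *s x) g \<noteq> 0} \<subseteq> ?S" "{g. component V (k *s y) g \<noteq> 0} \<subseteq> ?T"
    by (auto simp: component_scale)
  show "color_commutator scale V \<mu> \<epsilon> (k *s x) y = k *s color_commutator scale V \<mu> \<epsilon> x y"
    "color_commutator scale V \<mu> \<epsilon> x (k *s y) = k *s color_commutator scale V \<mu> \<epsilon> x y"
    using fin sub by (simp_all add: color_commutator_superset[where S = ?S and T = ?T]
        component_scale mult_linear scale_sum_right scale_right_diff_distrib mult.commute)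
qed

lemma bilinear_color_commutator: "bilinear_map scale (color_commutator scale V \<mu> \<epsilon>)"
  unfolding bilinear_map_def Vector_Spaces.linear_iff
  by (simp add: vector_space_axioms color_commutator_add_left color_commutator_add_right
      color_commutator_scale)

lemma even_color_commutator:
  assumes "x \<in> V a" "y \<in> V b"
  shows "color_commutator scale V \<mu> \<epsilon> x y \<in> V (a + b)"
  \<comment> \<open>The swapped product has degree \<open>b + a\<close>, which is
    \<open>a + b\<close> because the grading group is abelian.\<close>
  using even_mult[OF assms] even_mult[OF assms(2,1)]
  by (simp add: color_commutator_homogeneous[OF assms] add.commute subspace_V
      subspace_diff subspace_scale)

lemma skew_color_commutator:
  assumes "x \<in> V a" "y \<in> V b"
  shows "color_commutator scale V \<mu> \<epsilon> x y = - (\<epsilon> a b *s color_commutator scale V \<mu> \<epsilon> y x)"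
  by (simp add: color_commutator_homogeneous[OF assms] color_commutator_homogeneous[OF assms(2,1)]
      scale_right_diff_distrib inverse)

lemma trilinear_hom_associator: "trilinear_map scale (hom_associator \<mu> \<alpha>)"
  unfolding trilinear_map_def Vector_Spaces.linear_iff hom_associator_def
  by (simp add: vector_space_axioms mult_linear twist_linear scale_right_diff_distrib)

lemma even_hom_associator:
  assumes "x \<in> V a" "y \<in> V b" "z \<in> V c"
  shows "hom_associator \<mu> \<alpha> x y z \<in> V (a + b + c)"
proof -
  have "\<mu> (\<mu> x y) (\<alpha> z) \<in> V (a + b + c)" "\<mu> (\<alpha> x) (\<mu> y z) \<in> V (a + (b + c))"
    using assms by (auto intro!: even_mult even_twist)
  then show ?thesis
    by (simp add: hom_associator_def subspace_diff[OF subspace_V] add.assoc)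
qed

text \<open>Its three cyclic instances yield twelve products, exactly those occurring in the six
  associators of the Akivis identity.\<close>

lemma scaled_double_commutator:
  assumes "x \<in> V a" "y \<in> V b" "z \<in> V c"
  shows "\<epsilon> c a *s color_commutator scale V \<mu> \<epsilon> (color_commutator scale V \<mu> \<epsilon> x y) (\<alpha> z) =
    \<epsilon> c a *s \<mu> (\<mu> x y) (\<alpha> z) - (\<epsilon> c a * \<epsilon> a b) *s \<mu> (\<mu> y x) (\<alpha> z)
    - \<epsilon> b c *s \<mu> (\<alpha> z) (\<mu> x y) + (\<epsilon> a b * \<epsilon> b c) *s \<mu> (\<alpha> z) (\<mu> y x)"
proof -
  \<comment> \<open>The factor \<open>\<epsilon> a c\<close> of \<open>\<epsilon> (a + b) c\<close>
    cancels against \<open>\<epsilon> c a\<close>.\<close>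
  have 1: "\<epsilon> c a * \<epsilon> (a + b) c = \<epsilon> b c"
    using inverse[of c a] by (simp add: add_left flip: mult.assoc)
  then have 2: "\<epsilon> c a * (\<epsilon> (a + b) c * \<epsilon> a b) = \<epsilon> a b * \<epsilon> b c"
    by (metis mult.assoc mult.commute)
  show ?thesis
    \<comment> \<open>The outer bracket is expanded first, using that the inner one is homogeneous
      of degree \<open>a + b\<close>; its equation still mentions the inner commutator and would not
      match afterwards.\<close>
    unfolding color_commutator_homogeneous[OF even_color_commutator[OF assms(1,2)]
        even_twist[OF assms(3)]]
    unfolding color_commutator_homogeneous[OF assms(1,2)]
    by (simp add: mult_diff mult_linear scale_right_diff_distrib 1 2)
qed

lemma color_hom_akivis:
  "color_hom_akivis_algebra scale V (color_commutator scale V \<mu> \<epsilon>) (hom_associator \<mu> \<alpha>) \<epsilon> \<alpha>"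
proof unfold_locales
  fix x y z a b c
  assume h: "x \<in> V a" "y \<in> V b" "z \<in> V c"
  let ?br = "color_commutator scale V \<mu> \<epsilon>" and ?as = "hom_associator \<mu> \<alpha>"
  show "\<epsilon> c a *s ?br (?br x y) (\<alpha> z) + \<epsilon> a b *s ?br (?br y z) (\<alpha> x)
      + \<epsilon> b c *s ?br (?br z x) (\<alpha> y)
    = \<epsilon> c a *s (?as x y z - \<epsilon> a b *s ?as y x z) + \<epsilon> a b *s (?as y z x - \<epsilon> b c *s ?as z y x)
      + \<epsilon> b c *s (?as z x y - \<epsilon> c a *s ?as x z y)"
    \<comment> \<open>The permuted hypotheses are the cyclic rotations of
      \<open>(x, y, z)\<close>.\<close>
    unfolding scaled_double_commutator[OF h] scaled_double_commutator[OF h(2,3,1)]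
      scaled_double_commutator[OF h(3,1,2)] hom_associator_def
    by (simp add: scale_right_diff_distrib mult.commute)
qed (fact bilinear_color_commutator even_color_commutator skew_color_commutator
    trilinear_hom_associator even_hom_associator twist_linear even_twist)+

end

text \<open>The path is \<open>xyz\<close>, \<open>yxz\<close>, \<open>yzx\<close>,
  \<open>zyx\<close>, with factors \<open>\<epsilon> a b\<close>, \<open>\<epsilon> a c\<close>,
  \<open>\<epsilon> b c\<close>; three sign changes leave one minus.\<close>

lemma (in hom_alternative_color_algebra) alternative_outer:
  assumes "x \<in> V a" "y \<in> V b" "z \<in> V c"
  shows "hom_associator \<mu> \<alpha> x y z = - ((\<epsilon> a b * \<epsilon> a c * \<epsilon> b c) *s hom_associator \<mu> \<alpha> z y x)"
  using alternative_left[OF assms] alternative_right[OF assms(2,1,3)]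
    alternative_left[OF assms(2,3,1)]
  by (simp add: mult.assoc)

theorem theorem3p3:
  fixes scale :: "'k::field_char_0 \<Rightarrow> 'a::ab_group_add \<Rightarrow> 'a"
    and V :: "'g::ab_group_add \<Rightarrow> 'a set"
    and \<mu> :: "'a \<Rightarrow> 'a \<Rightarrow> 'a"
    and \<epsilon> :: "'g \<Rightarrow> 'g \<Rightarrow> 'k"
    and \<alpha> :: "'a \<Rightarrow> 'a"
  assumes "color_non_hom_assoc_algebra scale V \<mu> \<epsilon> \<alpha>"
  shows "(hom_flexible_color_algebra scale V \<mu> \<epsilon> \<alpha> \<longrightarrow>
            hom_flexible_color_hom_akivis_algebra scale V
              (color_commutator scale V \<mu> \<epsilon>) (hom_associator \<mu> \<alpha>) \<epsilon> \<alpha>) \<and>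
         (hom_alternative_color_algebra scale V \<mu> \<epsilon> \<alpha> \<longrightarrow>
            hom_alternative_color_hom_akivis_algebra scale V
              (color_commutator scale V \<mu> \<epsilon>) (hom_associator \<mu> \<alpha>) \<epsilon> \<alpha>)"
proof (intro conjI impI)
  note akivis = color_non_hom_assoc_algebra.color_hom_akivis[OF assms]
  show "hom_flexible_color_hom_akivis_algebra scale V
      (color_commutator scale V \<mu> \<epsilon>) (hom_associator \<mu> \<alpha>) \<epsilon> \<alpha>"
    if "hom_flexible_color_algebra scale V \<mu> \<epsilon> \<alpha>"
    \<comment> \<open>The ternary operation is the associator itself, so the two flexible laws
      coincide.\<close>
    using akivis hom_flexible_color_algebra.flexible[OF that]
    by (simp add: hom_flexible_color_hom_akivis_algebra_def
        hom_flexible_color_hom_akivis_algebra_axioms_def)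
  show "hom_alternative_color_hom_akivis_algebra scale V
      (color_commutator scale V \<mu> \<epsilon>) (hom_associator \<mu> \<alpha>) \<epsilon> \<alpha>"
    if "hom_alternative_color_algebra scale V \<mu> \<epsilon> \<alpha>"
  \<comment> \<open>Only the three alternating laws remain: two are the alternative laws, the third
    is \<open>alternative_outer\<close>.\<close>
  proof (rule hom_alternative_color_hom_akivis_algebra.intro[OF akivis], unfold_locales)
  qed (fact hom_alternative_color_algebra.alternative_left[OF that]
      hom_alternative_color_algebra.alternative_right[OF that]
      hom_alternative_color_algebra.alternative_outer[OF that])+
qed

end
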